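(* For every integer $L\geq 4$, the following coefficientwise inequality of formal power series in $q$ holds: $$ \frac{1}{(q;q^2)_L}\left(\frac{1-q^{2L-2}}{1-q^2}+q^3\genfrac{[}{]}{0pt}{}{L-2}{2}_{q^2}\right)\ \succeq\ q\,\genfrac{[}{]}{0pt}{}{L-2}{2}_{q}\,(-q^3;q)_{L-4}. $$
   Context: The $q$-Pochhammer symbol is $(a;q)_N=\prod_{j=0}^{N-1}(1-aq^j)$ for integers $N\ge 0$, with $(a;q)_0=1$; in particular $(q;q^2)_N=\prod_{j=0}^{N-1}(1-q^{2j+1})$ and $(-q^3;q)_N=\prod_{j=0}^{N-1}(1+q^{3+j})$. The Gaussian polynomial is $\genfrac{[}{]}{0pt}{}{m}{n}_{q}=\frac{(q;q)_m}{(q;q)_n(q;q)_{m-n}}$ for integers $m\ge n\ge 0$, and it equals $0$ otherwise; $\genfrac{[}{]}{0pt}{}{m}{n}_{q^2}$ denotes the same polynomial with $q$ replaced by $q^2$. Reciprocals are expanded as formal power series in $q$. For formal power series $A(q),B(q)$ in $q$, $A(q)\succeq B(q)$ means that every coefficient of $A(q)-B(q)$ is nonnegative. *)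

theory Defs
  imports "HOL-Computational_Algebra.Formal_Power_Series"
begin

definition q_pochhammer :: "'a::comm_ring_1 \<Rightarrow> 'a \<Rightarrow> nat \<Rightarrow> 'a" where
  "q_pochhammer a q N = (\<Prod>j<N. 1 - a * q ^ j)"

text \<open>The base \<open>q\<close> is itself a power series, so that \<open>fps_X ^ 2\<close> can be substituted for \<open>fps_X\<close>.
  The definition is meant for bases with zero constant coefficient; the denominator is then
  a unit, and the division is genuine (see \<open>gauss_binomial_mult\<close>).\<close>

definition gauss_binomial :: "'a::field fps \<Rightarrow> nat \<Rightarrow> nat \<Rightarrow> 'a fps" where
  "gauss_binomial q m n =
     (if n \<le> m
      then q_pochhammer q q m / (q_pochhammer q q n * q_pochhammer q q (m - n))
      else 0)"

definition fps_coeff_ge :: "'a::linordered_idom fps \<Rightarrow> 'a fps \<Rightarrow> bool" (infix \<open>\<succeq>\<close> 50) where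
  "A \<succeq> B \<longleftrightarrow> (\<forall>n. 0 \<le> fps_nth (A - B) n)"

lemma q_pochhammer_nth_0:
  fixes a q :: "'a::comm_ring_1 fps"
  assumes "fps_nth a 0 = 0"
  shows "fps_nth (q_pochhammer a q N) 0 = 1"
  unfolding q_pochhammer_def using assms by (induction N) simp_all

lemma gauss_binomial_mult:
  fixes q :: "'a::field fps"
  assumes "fps_nth q 0 = 0" and "n \<le> m"
  shows "gauss_binomial q m n * (q_pochhammer q q n * q_pochhammer q q (m - n))
           = q_pochhammer q q m"
proof -
  let ?d = "q_pochhammer q q n * q_pochhammer q q (m - n)"
  have "fps_nth ?d 0 \<noteq> 0"
    using q_pochhammer_nth_0[OF assms(1)] by simp
  then show ?thesis
    using assms(2) by (simp add: gauss_binomial_def fps_divide_unit mult.assoc inverse_mult_eq_1)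
qed

abbreviation q :: "rat fps" where
  "q \<equiv> fps_X"

end

theory Submission
  imports Defs
begin

text \<open>Put \<open>B\<close> for the Gaussian polynomial in \<open>q\<^sup>2\<close>, \<open>C = (1 - q\<^bsup>2L-2\<^esup>) / (1 - q\<^sup>2)\<close>, and
  \<open>P = 1 / (q;q\<^sup>2)\<^sub>L\<close>. Since \<open>(1 - q\<^sup>k)(1 + q\<^sup>k) = 1 - q\<^bsup>2k\<^esup>\<close>, the right-hand side equals
  \<open>q B D\<close> with \<open>D = (-q;q)\<^bsub>L-4\<^esub>\<close>, and the difference of the two sides is
  \<open>P (C - q (1 - q\<^sup>2) B) + q B (P - D)\<close>.
  A finite form of Euler's theorem on odd and distinct parts gives \<open>P \<succeq> D\<close>. Moreover \<open>B\<close> is a product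
  of polynomials \<open>T = \<Sum>\<^bsub>j<m\<^esub> q\<^bsup>4j\<^esup>\<close> and \<open>\<Sum>\<^bsub>i<s\<^esub> q\<^bsup>2i\<^esup>\<close>, so that
  \<open>C - q (1 - q\<^sup>2) B = (C - T) + (1 - q) T + q\<^bsup>2s+1\<^esup> T\<close>, where \<open>C \<succeq> T\<close> and the factor \<open>1 - q\<close> is
  absorbed by \<open>P\<close>.\<close>

section \<open>Power series with nonnegative coefficients\<close>

lemma fps_coeff_ge_iff_diff: "A \<succeq> B \<longleftrightarrow> A - B \<succeq> 0"
  by (simp add: fps_coeff_ge_def)

lemma fps_coeff_ge_0_add: "A \<succeq> 0 \<Longrightarrow> B \<succeq> 0 \<Longrightarrow> A + B \<succeq> 0"
  by (simp add: fps_coeff_ge_def)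

lemma fps_coeff_ge_0_mult: "A \<succeq> 0 \<Longrightarrow> B \<succeq> 0 \<Longrightarrow> A * B \<succeq> 0"
  by (simp add: fps_coeff_ge_def fps_mult_nth sum_nonneg)

lemma fps_coeff_ge_0_sum: "(\<And>i. i \<in> I \<Longrightarrow> f i \<succeq> 0) \<Longrightarrow> sum f I \<succeq> 0"
  by (simp add: fps_coeff_ge_def fps_sum_nth sum_nonneg)

lemma fps_coeff_ge_0_X_power: "(fps_X :: 'a::linordered_idom fps) ^ n \<succeq> 0"
  by (simp add: fps_coeff_ge_def fps_X_power_nth)

lemma fps_coeff_ge_0_prod: "(\<And>i. i \<in> I \<Longrightarrow> f i \<succeq> 0) \<Longrightarrow> prod f I \<succeq> 0"
proof (induction I rule: infinite_finite_induct)
  case (insert i I)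
  then show ?case
    by (simp add: fps_coeff_ge_0_mult)
qed (simp_all add: fps_coeff_ge_def)

text \<open>Geometric series: the coefficients of the inverse are the indicator of the multiples of
  \<open>k\<close>.\<close>

lemma fps_coeff_ge_0_inverse_one_minus_X_power:
  assumes "k > 0"
  shows "inverse (1 - (fps_X :: 'a::linordered_field fps) ^ k) \<succeq> 0"
proof -
  let ?f = "Abs_fps (\<lambda>n. if k dvd n then 1 else 0) :: 'a fps"
  have "fps_nth (?f * (1 - fps_X ^ k)) n = fps_nth 1 n" for n
  proof (cases "n < k")
    case True
    then show ?thesis
      by (auto simp: right_diff_distrib fps_X_power_mult_right_nth dest: dvd_imp_le)
  next
    case False
    then have "k dvd n - k \<longleftrightarrow> k dvd n"
      by (simp add: dvd_minus_self)
    with False assms show ?thesis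
      by (simp add: right_diff_distrib fps_X_power_mult_right_nth)
  qed
  then have "?f * (1 - fps_X ^ k) = 1"
    by (simp add: fps_eq_iff)
  then have "?f = inverse (1 - fps_X ^ k)"
    by (metis fps_inverse_unique mult.commute)
  moreover have "?f \<succeq> 0"
    by (simp add: fps_coeff_ge_def)
  ultimately show ?thesis
    by simp
qed

lemma fps_inverse_prod:
  fixes f :: "'b \<Rightarrow> 'a::field fps"
  shows "inverse (prod f I) = (\<Prod>i\<in>I. inverse (f i))"
  by (induction I rule: infinite_finite_induct) (simp_all add: fps_inverse_mult)

lemma fps_coeff_ge_0_inverse_prod_one_minus_X_power:
  assumes "\<And>i. i \<in> I \<Longrightarrow> k i > 0"
  shows "inverse (\<Prod>i\<in>I. 1 - (fps_X :: 'a::linordered_field fps) ^ k i) \<succeq> 0"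
  unfolding fps_inverse_prod
  by (intro fps_coeff_ge_0_prod fps_coeff_ge_0_inverse_one_minus_X_power assms)

section \<open>Finite form of Euler's theorem on odd and distinct parts\<close>

text \<open>Induction: on the right the exponents \<open>N + 1, ..., 2 * N\<close> become
  \<open>N + 2, ..., 2 * N + 2\<close>. The new odd factor supplies \<open>2 * N + 1\<close>, while
  the lowest factor \<open>1 - x ^ (N + 1)\<close> and the new \<open>1 + x ^ (N + 1)\<close> merge
  into the top one.\<close>

lemma prod_one_plus_X_power_mult_prod_odd:
  fixes x :: "'a::comm_ring_1"
  shows "(\<Prod>j<N. 1 + x ^ Suc j) * (\<Prod>j<N. 1 - x ^ (2 * j + 1)) = (\<Prod>j<N. 1 - x ^ (N + 1 + j))"
proof (induction N)
  case (Suc N)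
  have "(\<Prod>j<Suc N. 1 + x ^ Suc j) * (\<Prod>j<Suc N. 1 - x ^ (2 * j + 1))
      = (\<Prod>j<N. 1 - x ^ (N + 1 + j)) * (1 - x ^ (2 * N + 1)) * (1 + x ^ Suc N)"
    unfolding Suc.IH[symmetric] by (simp add: mult_ac)
  also have "\<dots> = (\<Prod>j<Suc N. 1 - x ^ (N + 1 + j)) * (1 + x ^ Suc N)"
    by (simp add: mult_2)
  also have "\<dots> = (\<Prod>j<N. 1 - x ^ (N + 2 + j)) * ((1 - x ^ Suc N) * (1 + x ^ Suc N))"
    unfolding prod.lessThan_Suc_shift by (simp add: mult_ac)
  also have "(1 - x ^ Suc N) * (1 + x ^ Suc N) = 1 - x ^ (Suc N + Suc N)"
    by (simp only: power_add) (simp add: algebra_simps)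
  finally show ?case
    by simp
qed simp

lemma inverse_prod_odd_ge_prod_distinct:
  assumes "N \<le> M"
  shows "inverse (\<Prod>j<M. 1 - (fps_X :: 'a::linordered_field fps) ^ (2 * j + 1))
           \<succeq> (\<Prod>j<N. 1 + fps_X ^ Suc j)"
proof -
  let ?x = "fps_X :: 'a fps"
  let ?D = "\<Prod>j<N. 1 + ?x ^ Suc j"
  let ?odd = "\<lambda>I. \<Prod>j\<in>I. 1 - ?x ^ (2 * j + 1)"
  let ?upper = "\<Prod>j<N. 1 - ?x ^ (N + 1 + j)"
  \<comment> \<open>By the finite identity \<open>V\<close> is the cofactor of \<open>?D\<close> in
    the inverse. Its coefficients are nonnegative and its constant term is 1, so
    \<open>V - 1\<close> stays nonnegative.\<close>
  define V where "V = inverse ?upper * inverse (?odd {N..<M})"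
  have "{..<M} = {..<N} \<union> {N..<M}"
    using assms by auto
  then have "?odd {..<M} = ?odd {..<N} * ?odd {N..<M}"
    by (simp add: prod.union_disjoint[symmetric] ivl_disj_int)
  then have D_odd: "?D * ?odd {..<M} = ?upper * ?odd {N..<M}"
    unfolding prod_one_plus_X_power_mult_prod_odd[symmetric] by (simp add: mult_ac)
  have nth_0: "fps_nth (\<Prod>j\<in>I. 1 - ?x ^ k j) 0 = 1" if "\<And>j. k j > 0" for I and k :: "nat \<Rightarrow> nat"
    using that by (induction I rule: infinite_finite_induct) simp_all
  have "?D * ?odd {..<M} * V = (inverse ?upper * ?upper) * (inverse (?odd {N..<M}) * ?odd {N..<M})"
    unfolding D_odd V_def by (simp only: mult_ac)
  also have "\<dots> = 1"
    using nth_0[of "\<lambda>j. N + 1 + j" "{..<N}"] nth_0[of "\<lambda>j. 2 * j + 1" "{N..<M}"]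
    by (simp add: inverse_mult_eq_1)
  finally have "inverse (?odd {..<M}) = ?D * V"
    by (intro fps_inverse_unique) (simp add: mult_ac)
  then have diff: "inverse (?odd {..<M}) - ?D = ?D * (V - 1)"
    by (simp add: algebra_simps)
  have "V \<succeq> 0"
    unfolding V_def
    by (intro fps_coeff_ge_0_mult fps_coeff_ge_0_inverse_prod_one_minus_X_power) simp_all
  moreover have "fps_nth V 0 = 1"
    using nth_0[of "\<lambda>j. N + 1 + j" "{..<N}"] nth_0[of "\<lambda>j. 2 * j + 1" "{N..<M}"]
    by (simp add: V_def)
  ultimately have "V - 1 \<succeq> 0"
    by (simp add: fps_coeff_ge_def)
  moreover have "?D \<succeq> 0"
    using fps_coeff_ge_0_X_power[of 0, where 'a = 'a]
    by (intro fps_coeff_ge_0_prod fps_coeff_ge_0_add fps_coeff_ge_0_X_power) simp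
  ultimately show ?thesis
    unfolding fps_coeff_ge_iff_diff[of "inverse _"] diff by (intro fps_coeff_ge_0_mult)
qed

section \<open>Gaussian polynomials with lower index 2\<close>

lemma one_minus_power_mult_eq_sum:
  fixes x :: "'a::comm_ring_1"
  shows "1 - x ^ (k * n) = (1 - x ^ k) * (\<Sum>i<n. x ^ (k * i))"
  by (simp add: power_mult one_diff_power_eq)

lemma gauss_binomial_2_mult:
  fixes x :: "'a::field fps"
  assumes "fps_nth x 0 = 0"
  shows "gauss_binomial x (N + 2) 2 * ((1 - x) * (1 - x ^ 2)) = (1 - x ^ (N + 1)) * (1 - x ^ (N + 2))"
proof -
  have "q_pochhammer x x N \<noteq> 0"
    using q_pochhammer_nth_0[OF assms, of x N] by auto
  moreover have "gauss_binomial x (N + 2) 2 * ((1 - x) * (1 - x ^ 2)) * q_pochhammer x x N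
      = (1 - x ^ (N + 1)) * (1 - x ^ (N + 2)) * q_pochhammer x x N"
    using gauss_binomial_mult[OF assms, of 2 "N + 2"]
    by (simp add: q_pochhammer_def numeral_2_eq_2 mult_ac)
  ultimately show ?thesis
    by simp
qed

lemma fps_X_power_neq_1:
  assumes "k > 0"
  shows "(fps_X :: 'a::comm_ring_1 fps) ^ k \<noteq> 1"
proof
  assume "(fps_X :: 'a fps) ^ k = 1"
  then have "fps_nth ((fps_X :: 'a fps) ^ k) 0 = fps_nth 1 0"
    by simp
  with assms show False
    by simp
qed

text \<open>One of \<open>N + 1\<close> and \<open>N + 2\<close> is even, so one numerator factor is
  divisible by \<open>1 - q ^ 4\<close> and the other by \<open>1 - q ^ 2\<close>. The bound on
  \<open>m\<close> later keeps the exponents of the first sum within those of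
  \<open>C\<close>.\<close>

lemma gauss_binomial_2_square_base_eq_sum_mult_sum:
  obtains m s where "2 * m \<le> N + 2"
    and "gauss_binomial (q ^ 2) (N + 2) 2 = (\<Sum>j<m. q ^ (4 * j)) * (\<Sum>i<s. q ^ (2 * i))"
proof -
  \<comment> \<open>\<open>m\<close> is half of the even one of \<open>N + 1\<close> and
    \<open>N + 2\<close>; \<open>s\<close> is the odd one.\<close>
  define m where "m = (N + 2) div 2"
  define s where "s = (if even N then N + 1 else N + 2)"
  have "gauss_binomial (q ^ 2) (N + 2) 2 * ((1 - q ^ 2) * (1 - q ^ 4))
      = (1 - q ^ (2 * (N + 1))) * (1 - q ^ (2 * (N + 2)))"
    using gauss_binomial_2_mult[of "q ^ 2" N] by (simp add: power_mult[symmetric] del: power_Suc)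
  also have "\<dots> = (1 - q ^ (4 * m)) * (1 - q ^ (2 * s))"
  proof (cases "even N")
    case True
    then have "2 * (N + 2) = 4 * m"
      by (simp add: m_def)
    with True show ?thesis
      by (simp only: s_def if_True mult.commute)
  next
    case False
    then have "2 * (N + 1) = 4 * m"
      by (auto simp: m_def elim: oddE)
    with False show ?thesis
      by (simp only: s_def if_False)
  qed
  also have "\<dots> = (\<Sum>j<m. q ^ (4 * j)) * (\<Sum>i<s. q ^ (2 * i)) * ((1 - q ^ 2) * (1 - q ^ 4))"
    unfolding one_minus_power_mult_eq_sum[of q 4 m] one_minus_power_mult_eq_sum[of q 2 s]
    by (simp only: mult_ac)
  finally have "gauss_binomial (q ^ 2) (N + 2) 2 = (\<Sum>j<m. q ^ (4 * j)) * (\<Sum>i<s. q ^ (2 * i))"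
    by (simp add: fps_X_power_neq_1)
  with that[of m s] show ?thesis
    by (simp add: m_def)
qed

text \<open>The factors \<open>1 + q\<close> and \<open>1 + q ^ 2\<close> complete the Pochhammer
  symbol to a product of \<open>N + 2\<close> factors. Its top two turn the numerator for base
  \<open>q\<close> into the one for base \<open>q ^ 2\<close>.\<close>

lemma gauss_binomial_2_mult_q_pochhammer:
  "gauss_binomial q (N + 2) 2 * q_pochhammer (- (q ^ 3)) q N
     = gauss_binomial (q ^ 2) (N + 2) 2 * (\<Prod>j<N. 1 + q ^ Suc j)"
proof -
  have shift: "(1 + q) * (1 + q ^ 2) * q_pochhammer (- (q ^ 3)) q N
      = (\<Prod>j<N. 1 + q ^ Suc j) * ((1 + q ^ (N + 1)) * (1 + q ^ (N + 2)))"
  proof -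
    have "q_pochhammer (- (q ^ 3)) q N = (\<Prod>j<N. 1 + q ^ Suc (Suc (Suc j)))"
      by (simp add: q_pochhammer_def numeral_3_eq_3 mult_ac)
    then have "(1 + q) * (1 + q ^ 2) * q_pochhammer (- (q ^ 3)) q N = (\<Prod>j<Suc (Suc N). 1 + q ^ Suc j)"
      by (simp only: prod.lessThan_Suc_shift) (simp add: numeral_2_eq_2 mult_ac)
    then show ?thesis
      by (simp add: mult_ac)
  qed
  have factor: "1 - q ^ (2 * k) = (1 - q ^ k) * (1 + q ^ k)" for k
    by (simp only: mult_2 power_add) (simp add: algebra_simps)
  have "gauss_binomial q (N + 2) 2 * q_pochhammer (- (q ^ 3)) q N * ((1 - q ^ 2) * (1 - q ^ 4))
      = gauss_binomial q (N + 2) 2 * ((1 - q) * (1 - q ^ 2))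
          * ((1 + q) * (1 + q ^ 2) * q_pochhammer (- (q ^ 3)) q N)"
    using factor[of 1] factor[of 2] by (simp add: mult_ac)
  also have "\<dots> = (1 - q ^ (2 * (N + 1))) * (1 - q ^ (2 * (N + 2))) * (\<Prod>j<N. 1 + q ^ Suc j)"
    using gauss_binomial_2_mult[of q N] unfolding shift factor by (simp add: mult_ac del: power_Suc)
  also have "\<dots> = gauss_binomial (q ^ 2) (N + 2) 2 * ((1 - q ^ 2) * (1 - q ^ 4)) * (\<Prod>j<N. 1 + q ^ Suc j)"
    using gauss_binomial_2_mult[of "q ^ 2" N] by (simp add: power_mult[symmetric] del: power_Suc)
  finally show ?thesis
    by (simp add: fps_X_power_neq_1)
qed

theorem corollary1p3:
  fixes L :: nat
  assumes "L \<ge> 4"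
  shows "1 / q_pochhammer q (q ^ 2) L
           * ((1 - q ^ (2 * L - 2)) / (1 - q ^ 2) + q ^ 3 * gauss_binomial (q ^ 2) (L - 2) 2)
         \<succeq> q * gauss_binomial q (L - 2) 2 * q_pochhammer (- (q ^ 3)) q (L - 4)"
proof -
  define N where "N = L - 4"
  have L: "L = N + 4"
    using assms by (simp add: N_def)
  define B where "B = gauss_binomial (q ^ 2) (N + 2) 2"
  define C where "C = (\<Sum>i<N + 3. q ^ (2 * i))"
  define D where "D = (\<Prod>j<N. 1 + q ^ Suc j)"
  define P where "P = inverse (\<Prod>j<N + 4. 1 - q ^ (2 * j + 1))"
  obtain m s where m: "2 * m \<le> N + 2"
    and B: "B = (\<Sum>j<m. q ^ (4 * j)) * (\<Sum>i<s. q ^ (2 * i))"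
    using gauss_binomial_2_square_base_eq_sum_mult_sum[of N] unfolding B_def by metis
  define T where "T = (\<Sum>j<m. q ^ (4 * j))"

  have "q_pochhammer q (q ^ 2) L = (\<Prod>j<N + 4. 1 - q ^ (2 * j + 1))"
    by (simp add: q_pochhammer_def L power_mult)
  moreover have "fps_nth (q_pochhammer q (q ^ 2) L) 0 = 1"
    by (simp add: q_pochhammer_nth_0)
  ultimately have P: "1 / q_pochhammer q (q ^ 2) L = P"
    by (simp add: P_def fps_divide_unit)
  have "2 * L - 2 = 2 * (N + 3)"
    by (simp add: L)
  then have "1 - q ^ (2 * L - 2) = (1 - q ^ 2) * C"
    unfolding C_def by (simp only: one_minus_power_mult_eq_sum)
  then have C: "(1 - q ^ (2 * L - 2)) / (1 - q ^ 2) = C"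
    by (simp add: fps_X_power_neq_1)
  have "(1 - q ^ 2) * B = (1 - q ^ (2 * s)) * T"
    unfolding B T_def one_minus_power_mult_eq_sum[of q 2 s] by (simp only: mult_ac)
  \<comment> \<open>Since \<open>q ^ 3 = q - q * (1 - q ^ 2)\<close>, this is the multiple that
    occurs in the difference of the two sides.\<close>
  then have "P * q * ((1 - q ^ 2) * B) = P * q * ((1 - q ^ (2 * s)) * T)"
    by simp
  then have diff: "P * (C + q ^ 3 * B) - q * (B * D)
      = P * (C - T) + P * (1 - q) * T + P * q ^ (2 * s + 1) * T + q * B * (P - D)"
    by (simp add: algebra_simps power2_eq_square power3_eq_cube)

  have T_nonneg: "T \<succeq> 0"
    unfolding T_def by (intro fps_coeff_ge_0_sum fps_coeff_ge_0_X_power)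
  have B_nonneg: "B \<succeq> 0"
    unfolding B by (intro fps_coeff_ge_0_mult fps_coeff_ge_0_sum fps_coeff_ge_0_X_power)
  have P_nonneg: "P \<succeq> 0"
    unfolding P_def by (intro fps_coeff_ge_0_inverse_prod_one_minus_X_power) simp
  have q_nonneg: "q ^ k \<succeq> 0" for k
    by (rule fps_coeff_ge_0_X_power)
  \<comment> \<open>The factor of \<open>P\<close> at \<open>j = 0\<close> is the inverse of
    \<open>1 - q\<close>; splitting it off lets it cancel.\<close>
  have "N + 4 = Suc (N + 3)"
    by simp
  then have "P = inverse ((1 - q) * (\<Prod>j<N + 3. 1 - q ^ (2 * Suc j + 1)))"
    unfolding P_def by (simp only: prod.lessThan_Suc_shift) simp
  also have "\<dots> * (1 - q)
      = (inverse (1 - q) * (1 - q)) * inverse (\<Prod>j<N + 3. 1 - q ^ (2 * Suc j + 1))"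
    by (simp only: fps_inverse_mult mult_ac)
  also have "inverse (1 - q) * (1 - q) = 1"
    by (simp add: inverse_mult_eq_1)
  finally have "P * (1 - q) = inverse (\<Prod>j<N + 3. 1 - q ^ (2 * Suc j + 1))"
    by simp
  then have P_one_minus_q_nonneg: "P * (1 - q) \<succeq> 0"
    using fps_coeff_ge_0_inverse_prod_one_minus_X_power[of "{..<N + 3}" "\<lambda>j. 2 * Suc j + 1"] by simp
  have C_minus_T_nonneg: "C - T \<succeq> 0"
  proof -
    \<comment> \<open>As \<open>4 * j = 2 * (2 * j)\<close>, \<open>T\<close> is the part of the sum
      \<open>C\<close> over the even indices below \<open>2 * m\<close>.\<close>
    let ?I = "(\<lambda>j. 2 * j) ` {..<m}"
    have "T = (\<Sum>i\<in>?I. q ^ (2 * i))"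
      by (simp add: T_def sum.reindex inj_on_def)
    moreover have "?I \<subseteq> {..<N + 3}"
      using m by auto
    ultimately have "C - T = (\<Sum>i\<in>{..<N + 3} - ?I. q ^ (2 * i))"
      by (simp add: C_def sum_diff)
    then show ?thesis
      by (simp add: fps_coeff_ge_0_sum q_nonneg)
  qed
  have P_minus_D_nonneg: "P - D \<succeq> 0"
    unfolding P_def D_def fps_coeff_ge_iff_diff[symmetric]
    by (rule inverse_prod_odd_ge_prod_distinct) simp
  have "P * (C + q ^ 3 * B) - q * (B * D) \<succeq> 0"
    unfolding diff using q_nonneg[of 1]
    by (intro fps_coeff_ge_0_add fps_coeff_ge_0_mult T_nonneg B_nonneg P_nonneg q_nonneg
        P_one_minus_q_nonneg C_minus_T_nonneg P_minus_D_nonneg) simp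
  then have "P * (C + q ^ 3 * B) \<succeq> q * (B * D)"
    by (subst fps_coeff_ge_iff_diff)
  moreover have "L - 2 = N + 2"
    by (simp add: L)
  ultimately show ?thesis
    unfolding P C N_def[symmetric]
    by (simp only: mult.assoc gauss_binomial_2_mult_q_pochhammer B_def D_def)
qed

end
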